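(* Let $G$ be a tree that admits a non-trivial balanced equivalence relation $\bowtie$ on $V(G)$. Then at least two (distinct) leaves of $G$ are in the same $\bowtie$-class.
   Context: Graphs are finite and simple (undirected, no multiple edges, no loops). A tree is a connected graph without cycles; a leaf is a vertex of degree one. An equivalence relation $\bowtie$ on $V(G)$ is balanced if, whenever $c\bowtie d$, there is a bijection $\beta$ from the set of neighbors of $c$ to the set of neighbors of $d$ with $v\bowtie\beta(v)$ for every neighbor $v$ of $c$. It is trivial if every class is a singleton, and non-trivial otherwise. *)

theory Defs
  imports Graph_Theory.Digraph_Component
begin

text \<open>A finite simple graph is a \<open>pair_graph\<close>: a finite, loop-free, symmetric set of
  arcs, each undirected edge being a pair of opposite arcs.\<close>

definition neighbors :: "'a pair_pre_digraph \<Rightarrow> 'a \<Rightarrow> 'a set" where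
  "neighbors G v = {w. v \<rightarrow>\<^bsub>with_proj G\<^esub> w}"

text \<open>The library predicates \<open>forest\<close> and \<open>tree\<close> are not usable for undirected graphs: they
  count the closed walk \<open>u, v, u\<close> along a single edge, which is a directed cycle of length 2,
  as a cycle. In a simple graph the cycles in the undirected sense are exactly the directed
  cycles of length at least 3. Since \<open>connected\<close> excludes the null graph, so does
  \<open>undirected_tree\<close>.\<close>

definition undirected_cycle :: "'a pair_pre_digraph \<Rightarrow> ('a \<times> 'a) awalk \<Rightarrow> bool" where
  "undirected_cycle G p \<longleftrightarrow> pre_digraph.cycle (with_proj G) p \<and> length p \<ge> 3"

definition undirected_tree :: "'a pair_pre_digraph \<Rightarrow> bool" where
  "undirected_tree G \<longleftrightarrow>
    pair_graph G \<and> connected (with_proj G) \<and> \<not> (\<exists>p. undirected_cycle G p)"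

text \<open>By symmetry, the degree of a vertex is its out-degree.\<close>

definition leaf :: "'a pair_pre_digraph \<Rightarrow> 'a \<Rightarrow> bool" where
  "leaf G v \<longleftrightarrow> v \<in> pverts G \<and> out_degree (with_proj G) v = 1"

definition balanced_equiv :: "'a pair_pre_digraph \<Rightarrow> 'a rel \<Rightarrow> bool" where
  "balanced_equiv G R \<longleftrightarrow> equiv (pverts G) R \<and>
    (\<forall>c d. (c, d) \<in> R \<longrightarrow>
      (\<exists>\<beta>. bij_betw \<beta> (neighbors G c) (neighbors G d) \<and> (\<forall>v \<in> neighbors G c. (v, \<beta> v) \<in> R)))"

definition trivial_equiv :: "'a set \<Rightarrow> 'a rel \<Rightarrow> bool" where
  "trivial_equiv A R \<longleftrightarrow> (\<forall>C \<in> A // R. is_singleton C)"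

end

theory Submission
  imports Defs
begin

text \<open>If no leaf lies in a non-singleton class, root the tree at a leaf \<open>l\<close>, whose class is then a
  singleton. Balancedness lifts walks along equivalent starting points, so equivalent vertices have
  the same distance to \<open>l\<close>. Let \<open>x\<close> be a vertex of a non-singleton class at maximal distance from
  \<open>l\<close>, and let \<open>y \<noteq> x\<close> be equivalent to \<open>x\<close>. If \<open>x\<close> is not a leaf, it has a child \<open>z\<close>; the class of
  \<open>z\<close> is a singleton by maximality, so \<open>z\<close> is also adjacent to \<open>y\<close> and has two parents, which is
  impossible in a tree. So \<open>x\<close> is a leaf after all.\<close>

text \<open>The graph distance from \<open>x\<close> to \<open>r\<close>, meaningful only if
  \<open>r\<close> is reachable from \<open>x\<close>. Relation powers stand for walks, so that
  lifting along \<open>R\<close> is an induction on the exponent.\<close>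

definition hops :: "'a rel \<Rightarrow> 'a \<Rightarrow> 'a \<Rightarrow> nat" where
  "hops E r x = (LEAST n. (x, r) \<in> E ^^ n)"

lemma hops_relpow:
  assumes "(x, r) \<in> E\<^sup>*"
  shows "(x, r) \<in> E ^^ hops E r x"
  using assms unfolding hops_def by (metis LeastI rtrancl_power)

lemma not_relpow_if_less_hops: "m < hops E r x \<Longrightarrow> (x, r) \<notin> E ^^ m"
  unfolding hops_def by (rule not_less_Least)

text \<open>A visit to \<open>z\<close> cannot be at the start, so it would leave fewer than
  \<open>n\<close> steps from \<open>z\<close> to \<open>r\<close>. Hence a shortest walk to
  \<open>r\<close> avoids every other vertex that is at least as far from \<open>r\<close> as its
  start.\<close>

lemma relpow_avoids:
  assumes "(x, r) \<in> E ^^ n" "x \<noteq> z" "\<And>m. m < n \<Longrightarrow> (z, r) \<notin> E ^^ m"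
  shows "(x, r) \<in> {(a, b) \<in> E. a \<noteq> z \<and> b \<noteq> z}\<^sup>*"
  using assms
proof (induction n arbitrary: x)
  case (Suc n)
  then obtain w where w: "(x, w) \<in> E" "(w, r) \<in> E ^^ n"
    by (meson relpow_Suc_E2)
  with Suc.prems(3) have "w \<noteq> z" by blast
  with Suc w have "(w, r) \<in> {(a, b) \<in> E. a \<noteq> z \<and> b \<noteq> z}\<^sup>*" by simp
  with w(1) \<open>w \<noteq> z\<close> \<open>x \<noteq> z\<close> show ?case
    by (auto intro: converse_rtrancl_into_rtrancl)
qed simp

lemma neighbors_conv: "neighbors G v = {w. (v, w) \<in> parcs G}"
  by (simp add: neighbors_def)

lemma out_degree_eq_card_neighbors: "out_degree (with_proj G) v = card (neighbors G v)"
proof -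
  have "out_arcs (with_proj G) v = Pair v ` neighbors G v"
    by (auto simp: out_arcs_def neighbors_conv)
  then show ?thesis
    by (simp add: out_degree_def card_image inj_on_def)
qed

lemma leaf_if_unique_neighbor:
  assumes "v \<in> pverts G" "w \<in> neighbors G v" "\<And>u. u \<in> neighbors G v \<Longrightarrow> u = w"
  shows "leaf G v"
proof -
  have "neighbors G v = {w}" using assms(2,3) by blast
  with assms(1) show ?thesis by (simp add: leaf_def out_degree_eq_card_neighbors)
qed

lemma pawalk_verts_snoc:
  "pcas x q y \<Longrightarrow> pawalk_verts x (q @ [(y, z)]) = pawalk_verts x q @ [z]"
  by (induction q arbitrary: x) auto

text \<open>The two arcs at \<open>z\<close> close up a path between its neighbors.\<close>

lemma (in pair_graph) undirected_cycle_if_avoiding_path: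
  assumes "x \<in> neighbors G z" "y \<in> neighbors G z" "x \<noteq> y"
    and path: "(x, y) \<in> {(a, b) \<in> parcs G. a \<noteq> z \<and> b \<noteq> z}\<^sup>*"
  shows "\<exists>p. undirected_cycle G p"
proof -
  have arcs: "(z, x) \<in> parcs G" "(y, z) \<in> parcs G"
    using assms by (auto simp: neighbors_conv intro: arcs_symmetric)
  then have "x \<noteq> z" using no_loops' by blast
  from path have "\<exists>q. awalk x q y \<and> set q \<subseteq> {(a, b). a \<noteq> z \<and> b \<noteq> z}"
  proof (induction rule: converse_rtrancl_induct)
    case base
    have "awalk y [] y" using arcs by (auto simp: awalk_Nil_iff dest: in_arcsD1)
    then show ?case by force
  next
    case (step a b)
    then obtain q where "awalk b q y" "set q \<subseteq> {(a, b). a \<noteq> z \<and> b \<noteq> z}" by blast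
    with step.hyps(1) show ?case
      by (intro exI[of _ "(a, b) # q"]) (auto simp: awalk_Cons_iff)
  qed
  then obtain w where w: "awalk x w y" "set w \<subseteq> {(a, b). a \<noteq> z \<and> b \<noteq> z}" by blast
  \<comment> \<open>A cycle must not repeat vertices, so the walk is cut down to a path; its arcs
    are among those of \<open>w\<close> and still avoid \<open>z\<close>.\<close>
  define q where "q = awalk_to_apath w"
  have q: "apath x q y" "set q \<subseteq> {(a, b). a \<noteq> z \<and> b \<noteq> z}"
    using apath_awalk_to_apath[OF w(1)] awalk_to_apath_subset[OF w(1)] w(2)
    unfolding q_def by blast+
  then have qw: "awalk x q y" and cas: "pcas x q y" and dist: "distinct (pawalk_verts x q)"
    unfolding apath_def awalk_def by blast+
  have "q \<noteq> []" using cas \<open>x \<noteq> y\<close> by auto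
  have "z \<notin> set (pawalk_verts x q)"
    using set_awalk_verts[OF qw] q(2) \<open>x \<noteq> z\<close> by auto
  \<comment> \<open>\<open>tl\<close> drops the first of the two occurrences of
    \<open>z\<close>.\<close>
  then have "distinct (tl (pawalk_verts z ((z, x) # q @ [(y, z)])))"
    using dist by (simp add: pawalk_verts_snoc[OF cas])
  moreover have "awalk y [(y, z)] z"
    using arcs in_arcsD1 by (simp add: awalk_Cons_iff awalk_Nil_iff)
  then have "awalk z ((z, x) # q @ [(y, z)]) z"
    using awalk_appendI[OF qw] arcs(1) by (simp add: awalk_Cons_iff del: awalk_append_iff)
  ultimately have "cycle ((z, x) # q @ [(y, z)])"
    unfolding cycle_def by blast
  \<comment> \<open>Here \<open>x \<noteq> y\<close> matters: it makes \<open>q\<close> nonempty and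
    rules out going back and forth along one edge.\<close>
  moreover have "3 \<le> length ((z, x) # q @ [(y, z)])"
    using \<open>q \<noteq> []\<close> by (cases q) auto
  ultimately show ?thesis unfolding undirected_cycle_def by blast
qed

locale undirected_tree_graph = pair_graph G for G :: "'a pair_pre_digraph" +
  assumes connected: "connected (with_proj G)"
    and acyclic: "\<not> undirected_cycle G p"
begin

lemma reach: "u \<in> pverts G \<Longrightarrow> v \<in> pverts G \<Longrightarrow> (u, v) \<in> (parcs G)\<^sup>*"
  using symmetric_connected_imp_strongly_connected[OF pair_sym_arcs connected]
  by (auto simp: strongly_connected_def reachable_def intro: rtrancl_on_rtranclI)

text \<open>Shortest walks from \<open>x\<close> and \<open>y\<close> to \<open>r\<close> avoid
  \<open>z\<close>; joined at \<open>r\<close> they would yield a cycle through \<open>z\<close>.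
  With \<le> instead of <, the bounds are exactly the negation of having a child.\<close>

lemma parent_unique:
  assumes "r \<in> pverts G" "x \<in> neighbors G z" "y \<in> neighbors G z"
    and "hops (parcs G) r x \<le> hops (parcs G) r z" "hops (parcs G) r y \<le> hops (parcs G) r z"
  shows "x = y"
proof (rule ccontr)
  assume "x \<noteq> y"
  let ?E = "{(a, b) \<in> parcs G. a \<noteq> z \<and> b \<noteq> z}"
  have to_root: "(v, r) \<in> ?E\<^sup>*"
    if "v \<in> neighbors G z" "hops (parcs G) r v \<le> hops (parcs G) r z" for v
  proof (rule relpow_avoids)
    have "(z, v) \<in> parcs G" using that by (simp add: neighbors_conv)
    then show "v \<noteq> z" and "(v, r) \<in> parcs G ^^ hops (parcs G) r v"
      using no_loops' hops_relpow[OF reach[OF in_arcsD2 assms(1)]] by blast+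
    show "(z, r) \<notin> parcs G ^^ m" if "m < hops (parcs G) r v" for m
      using that \<open>hops (parcs G) r v \<le> _\<close> by (intro not_relpow_if_less_hops) simp
  qed
  \<comment> \<open>Symmetry allows the walk from \<open>y\<close> to \<open>r\<close> to be
    reversed.\<close>
  have "sym ?E" using arcs_symmetric by (auto simp: sym_def)
  then have "(x, y) \<in> ?E\<^sup>*"
    using to_root[of x] to_root[of y] assms by (meson rtrancl_trans sym_rtrancl symD)
  then show False
    using undirected_cycle_if_avoiding_path assms(2,3) \<open>x \<noteq> y\<close> acyclic by blast
qed

lemma exists_neighbor:
  assumes "v \<in> pverts G" "w \<in> pverts G" "v \<noteq> w"
  shows "\<exists>u. u \<in> neighbors G v"
  using reach[OF assms(1,2)] assms(3) by (auto simp: neighbors_conv elim: converse_rtranclE)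

text \<open>Without a child, all neighbors of \<open>x\<close> coincide by
  \<open>parent_unique\<close>; \<open>w\<close> ensures that there is one.\<close>

lemma leaf_or_child:
  assumes "r \<in> pverts G" "x \<in> pverts G" "w \<in> pverts G" "x \<noteq> w"
  shows "leaf G x \<or> (\<exists>z\<in>neighbors G x. hops (parcs G) r x < hops (parcs G) r z)"
proof (rule disjCI)
  assume "\<not> (\<exists>z\<in>neighbors G x. hops (parcs G) r x < hops (parcs G) r z)"
  then have "u = v" if "u \<in> neighbors G x" "v \<in> neighbors G x" for u v
    using parent_unique[OF assms(1) that] that by force
  moreover obtain u where "u \<in> neighbors G x" using exists_neighbor assms by blast
  ultimately show "leaf G x" using assms(2) leaf_if_unique_neighbor by metis
qed

text \<open>A vertex farthest from \<open>v\<close> has no child.\<close>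

lemma exists_leaf:
  assumes "v \<in> pverts G" "w \<in> pverts G" "v \<noteq> w"
  shows "\<exists>l. leaf G l"
proof -
  let ?h = "hops (parcs G) v"
  obtain x where x: "x \<in> pverts G" "\<And>z. z \<in> pverts G \<Longrightarrow> ?h z \<le> ?h x"
    using obtains_MAX[of "pverts G" ?h] pair_finite_verts assms(1)
    by (metis Max_ge empty_iff finite_imageI imageI)
  have "\<not> ?h x < ?h z" if "z \<in> neighbors G x" for z
    using x(2)[of z] that by (auto simp: neighbors_conv dest: in_arcsD2)
  moreover obtain u where "u \<in> pverts G" "x \<noteq> u" using assms by metis
  ultimately show ?thesis using leaf_or_child[of v x u] assms(1) x(1) by blast
qed

end

lemma undirected_tree_graphI: "undirected_tree G \<Longrightarrow> undirected_tree_graph G"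
  by (simp add: undirected_tree_def undirected_tree_graph_def undirected_tree_graph_axioms_def)

lemma balanced_equivD:
  assumes "balanced_equiv G R" "(c, d) \<in> R"
  shows "card (neighbors G c) = card (neighbors G d)"
    and "v \<in> neighbors G c \<Longrightarrow> \<exists>w \<in> neighbors G d. (v, w) \<in> R"
proof -
  obtain \<beta> where "bij_betw \<beta> (neighbors G c) (neighbors G d)" "\<forall>v \<in> neighbors G c. (v, \<beta> v) \<in> R"
    using assms unfolding balanced_equiv_def by blast
  then show "card (neighbors G c) = card (neighbors G d)"
    and "v \<in> neighbors G c \<Longrightarrow> \<exists>w \<in> neighbors G d. (v, w) \<in> R"
    by (auto simp: bij_betw_same_card dest: bij_betw_apply)
qed

text \<open>Degree is constant on classes, so a class containing one leaf consists of
  leaves.\<close>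

lemma leaf_transfer:
  assumes "balanced_equiv G R" "(u, v) \<in> R" "leaf G u"
  shows "leaf G v"
proof -
  have "v \<in> pverts G"
    using assms(1,2) unfolding balanced_equiv_def by (meson equiv_class_eq_iff)
  then show ?thesis
    using assms balanced_equivD(1)[OF assms(1,2)] by (simp add: leaf_def out_degree_eq_card_neighbors)
qed

text \<open>The walk is copied arc by arc through the bijections; its endpoint is controlled only up
  to \<open>R\<close>.\<close>

lemma relpow_lift:
  assumes "balanced_equiv G R" "(x, l) \<in> parcs G ^^ n" "(x, y) \<in> R"
  shows "\<exists>l'. (l, l') \<in> R \<and> (y, l') \<in> parcs G ^^ n"
  using assms(2,3)
proof (induction n arbitrary: x y)
  case (Suc n)
  then obtain v where v: "(x, v) \<in> parcs G" "(v, l) \<in> parcs G ^^ n"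
    by (meson relpow_Suc_E2)
  then obtain w where "(y, w) \<in> parcs G" "(v, w) \<in> R"
    using balanced_equivD(2)[OF assms(1) Suc.prems(2), of v] by (auto simp: neighbors_conv)
  with Suc.IH v(2) show ?case by (meson relpow_Suc_I2)
qed auto

text \<open>The singleton class of \<open>l\<close> forces lifted walks to end at \<open>l\<close>,
  so \<open>x\<close> and \<open>y\<close> have walks to \<open>l\<close> of the same
  lengths.\<close>

lemma hops_cong:
  assumes "balanced_equiv G R" "(x, y) \<in> R" "\<And>l'. (l, l') \<in> R \<Longrightarrow> l' = l"
  shows "hops (parcs G) l x = hops (parcs G) l y"
proof -
  have "(y, x) \<in> R"
    using assms(1,2) unfolding balanced_equiv_def by (meson equivE symD)
  then have "(x, l) \<in> parcs G ^^ n \<longleftrightarrow> (y, l) \<in> parcs G ^^ n" for n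
    using relpow_lift[OF assms(1), of _ l n] assms(2,3) by blast
  then show ?thesis by (simp add: hops_def)
qed

lemma nontrivial_equivE:
  assumes "equiv A R" "\<not> trivial_equiv A R"
  obtains c d where "(c, d) \<in> R" "c \<noteq> d"
proof -
  obtain c where c: "c \<in> A" "\<not> is_singleton (R `` {c})"
    using assms(2) by (auto simp: trivial_equiv_def elim: quotientE)
  then have "c \<in> R `` {c}" using equiv_class_self[OF assms(1)] by blast
  with c(2) have "R `` {c} \<noteq> {c}" by (metis is_singletonI)
  with \<open>c \<in> R `` {c}\<close> show thesis using that by auto
qed

theorem proposition3p3:
  fixes G :: "'a pair_pre_digraph" and R :: "'a rel"
  assumes "undirected_tree G"
    and "balanced_equiv G R"
    and "\<not> trivial_equiv (pverts G) R"
  shows "\<exists>u v. leaf G u \<and> leaf G v \<and> u \<noteq> v \<and> (u, v) \<in> R"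
proof (rule ccontr)
  assume no_leaves: "\<not> ?thesis"
  interpret undirected_tree_graph G by (rule undirected_tree_graphI) fact
  have R: "equiv (pverts G) R" using assms(2) by (simp add: balanced_equiv_def)
  then have R_verts: "u \<in> pverts G" "v \<in> pverts G" if "(u, v) \<in> R" for u v
    using that by (auto simp: equiv_class_eq_iff)
  \<comment> \<open>The union of the non-singleton classes.\<close>
  define U where "U = {x. \<exists>y. (x, y) \<in> R \<and> x \<noteq> y}"
  have no_leaf_U: "\<not> leaf G x" if "x \<in> U" for x
    using that no_leaves leaf_transfer[OF assms(2)] by (auto simp: U_def)
  obtain c d where cd: "(c, d) \<in> R" "c \<noteq> d" using nontrivial_equivE R assms(3) by blast
  \<comment> \<open>Any leaf serves as root: by \<open>no_leaf_U\<close> its class is a singleton,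
    as \<open>hops_cong\<close> requires.\<close>
  obtain l where l: "leaf G l" using exists_leaf cd R_verts by blast
  let ?h = "hops (parcs G) l"
  have lV: "l \<in> pverts G" using l by (simp add: leaf_def)
  have "l \<notin> U" using l no_leaf_U by blast
  have "finite U" "c \<in> U"
    using cd R_verts by (auto simp: U_def intro: finite_subset[OF _ pair_finite_verts])
  then obtain x where x: "x \<in> U" "\<And>z. z \<in> U \<Longrightarrow> ?h z \<le> ?h x"
    using obtains_MAX[of U ?h] by (metis Max_ge empty_iff finite_imageI imageI)
  then obtain y where y: "(x, y) \<in> R" "x \<noteq> y" by (auto simp: U_def)
  have hxy: "?h x = ?h y" using hops_cong[OF assms(2) y(1)] \<open>l \<notin> U\<close> by (auto simp: U_def)
  obtain z where z: "z \<in> neighbors G x" "?h x < ?h z"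
    using leaf_or_child[OF lV R_verts[OF y(1)] y(2)] no_leaf_U x(1) by blast
  have "z \<notin> U" using x(2) z(2) by force
  then have "z \<in> neighbors G y"
    using balanced_equivD(2)[OF assms(2) y(1) z(1)] by (auto simp: U_def)
  \<comment> \<open>By \<open>hxy\<close>, \<open>y\<close> is also closer to \<open>l\<close> than
    \<open>z\<close> is.\<close>
  then have "x = y"
    using z hxy by (intro parent_unique[OF lV, of x z y]) (auto simp: neighbors_conv intro: arcs_symmetric)
  with y(2) show False by blast
qed

end
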